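(* (1) Let $G=T_{\frac{\pi}{6},2}$, $x=(x_1,x_2)\in G$, $r>0$. Then the metric ball $B_{s_G}(x,r)$ is smooth if and only if $r\le r_0$ or $r\le r_1$, where $$r_0=\min\left\{\frac{2|x_2|}{|x|},\ \frac{|x_2|-\sqrt{3}\,x_1+2}{\sqrt{(x_1-\sqrt{3})^2+(1-|x_2|)^2}}\right\},\qquad r_1=\frac{\sqrt{3}\,x_1-2-|x_2|}{\sqrt{(x_1-\sqrt{3})^2+(1-|x_2|)^2}}.$$ (2) Let $a\ge b>0$, $G=R_{a,b}$, $x=(x_1,x_2)\in G$, $r>0$. Then the metric ball $B_{s_G}(x,r)$ is smooth if and only if $r\le r_2$ or $r\le r_3$, where $$r_2=\min\left\{\frac{|x_2|}{b},\ \frac{(a-|x_1|)-(b-|x_2|)}{\sqrt{(a-|x_1|)^2+(b-|x_2|)^2}}\right\},\qquad r_3=\min\left\{\frac{|x_1|}{a},\ \frac{(b-|x_2|)-(a-|x_1|)}{\sqrt{(a-|x_1|)^2+(b-|x_2|)^2}}\right\}.$$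
   Context: $T_{\frac{\pi}{6},2}\subset\mathbb{R}^2$ is the (open) equilateral triangle with vertices $(0,0)$, $(\sqrt{3},1)$, $(\sqrt{3},-1)$. For $a\ge b>0$, $R_{a,b}\subset\mathbb{R}^2$ is the (open) rectangle with vertices $(a,b)$, $(a,-b)$, $(-a,b)$, $(-a,-b)$. For a domain $G\subsetneq\mathbb{R}^2$ and $x,y\in G$, $$s_G(x,y)=\sup_{z\in\partial G}\frac{|x-y|}{|x-z|+|z-y|},\qquad B_{s_G}(x,r)=\{z\in G: s_G(x,z)<r\}.$$ A metric ball is called smooth if its boundary is a smooth curve (in particular, has no corners). *)

theory Defs
  imports "HOL-Analysis.Analysis"
begin

definition triangle_G :: "(real^2) set" where
  "triangle_G = interior (convex hull {vector [0, 0], vector [sqrt 3, 1], vector [sqrt 3, -1]})"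

definition rectangle_G :: "real \<Rightarrow> real \<Rightarrow> (real^2) set" where
  "rectangle_G a b =
     interior (convex hull {vector [a, b], vector [a, -b], vector [-a, b], vector [-a, -b]})"

text \<open>The triangular ratio metric. For open \<open>G \<noteq> UNIV\<close> and \<open>x, y \<in> G\<close> the supremum is over a
  nonempty set bounded above by 1, with positive denominators.\<close>

definition triangular_ratio :: "(real^2) set \<Rightarrow> real^2 \<Rightarrow> real^2 \<Rightarrow> real" where
  "triangular_ratio G x y = (SUP z\<in>frontier G. norm (x - y) / (norm (x - z) + norm (z - y)))"

definition triangular_ratio_ball :: "(real^2) set \<Rightarrow> real^2 \<Rightarrow> real \<Rightarrow> (real^2) set" where
  "triangular_ratio_ball G x r = {z \<in> G. triangular_ratio G x z < r}"

text \<open>A smooth closed curve is the trace of a 1-periodic parametrization of class $C^\infty$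
  (\<open>D n\<close> is its \<open>n\<close>-th derivative) that is regular and injective on one period. Periodicity makes
  all derivatives match up at the base point, and regularity excludes corners and cusps.\<close>

definition smooth_closed_curve :: "(real^2) set \<Rightarrow> bool" where
  "smooth_closed_curve S \<longleftrightarrow>
     (\<exists>D :: nat \<Rightarrow> real \<Rightarrow> real^2.
        (\<forall>n t. (D n has_vector_derivative D (Suc n) t) (at t)) \<and>
        (\<forall>t. D 0 (t + 1) = D 0 t) \<and>
        (\<forall>t. D 1 t \<noteq> 0) \<and>
        inj_on (D 0) {0..<1} \<and>
        S = range (D 0))"

definition smooth_ball :: "(real^2) set \<Rightarrow> real^2 \<Rightarrow> real \<Rightarrow> bool" where
  "smooth_ball G x r \<longleftrightarrow> smooth_closed_curve (frontier (triangular_ratio_ball G x r))"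

end

theory Submission
  imports Defs
begin

text \<open>In a convex polygon the triangular ratio of \<open>x\<close> and \<open>y\<close> is the largest among the ratios with respect to
  the lines of the sides, and for a line \<open>L\<close> this ratio is \<open>|x - y| / |x' - y|\<close>, where \<open>x'\<close> is the mirror
  image of \<open>x\<close> in \<open>L\<close> (lemma \<open>triangular_ratio_less_iff\<close>). For \<open>r < 1\<close> the set of points \<open>y\<close> with
  \<open>|x - y| < r * |x' - y|\<close> is a disc of Apollonius, so the ball of radius \<open>r\<close> is an intersection of discs, one
  for each side. If one of the discs is contained in all the others, its boundary circle bounds the ball. If none
  is, the boundary of the ball passes from one circle to another one, and the passage is a corner
  (lemma \<open>smooth_frontier_Inter_balls\<close>). For \<open>r \<ge> 1\<close> the ball is the polygon, which has corners too.

  So smoothness is the existence of a side whose disc is contained in those of all other sides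
  (theorem \<open>smooth_ball_polygon_iff\<close>). If \<open>h\<close> and \<open>h'\<close> are the distances of \<open>x\<close> to two sides, the disc of the
  first side is contained in that of the second one if and only if \<open>r * \<delta> \<le> h' - h\<close>, where \<open>\<delta>\<close> is the
  distance between the feet of the perpendiculars from \<open>x\<close> to the two sides. Such a first side is a nearest
  side of the polygon. For the triangle, the first bound on the radius belongs to the case that a side through the
  origin is nearest, and the second bound to the vertical side; for the rectangle, the two bounds belong to a
  horizontal and a vertical nearest side.\<close>

section \<open>Reflection in the sides of a polygon\<close>

text \<open>A pair \<open>(n, c)\<close> stands for the half-plane \<open>n \<bullet> y + c > 0\<close>. When \<open>n\<close> is a unit vector, the height
  of a point is its signed distance to the boundary line, positive inside.\<close>

definition height :: "(real^2) \<times> real \<Rightarrow> real^2 \<Rightarrow> real" where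
  "height L y = fst L \<bullet> y + snd L"

definition polygon :: "((real^2) \<times> real) set \<Rightarrow> (real^2) set" where
  "polygon H = {y. \<forall>L\<in>H. 0 < height L y}"

text \<open>Reflection in the line of a side, so that the length of a broken path from \<open>x\<close> to \<open>y\<close> touching
  that line is the length of a path from the mirror image of \<open>x\<close>.\<close>

definition mirror :: "(real^2) \<times> real \<Rightarrow> real^2 \<Rightarrow> real^2" where
  "mirror L x = x - (2 * height L x) *\<^sub>R fst L"

text \<open>Moving \<open>x\<close> to its mirror image changes only the component of \<open>x - y\<close> along the normal, from
  the difference of the two heights to their sum (up to sign); the squares differ by four times
  their product.\<close>

lemma dist_mirror_square:
  assumes "norm (fst L) = 1"
  shows "(norm (mirror L x - y))\<^sup>2 = (norm (x - y))\<^sup>2 + 4 * height L x * height L y"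
proof -
  have n: "fst L \<bullet> fst L = 1" using assms by (simp add: norm_eq_1)
  show ?thesis
    unfolding power2_norm_eq_inner mirror_def height_def
    using n by (simp add: inner_diff inner_add inner_commute algebra_simps)
qed

lemma open_polygon: "finite H \<Longrightarrow> open (polygon H)"
proof -
  assume f: "finite H"
  have "polygon H = (\<Inter>L\<in>H. {y. 0 < height L y})" by (auto simp: polygon_def)
  moreover have "open {y. 0 < height L y}" for L
    unfolding height_def by (intro open_Collect_less continuous_intros)
  ultimately show ?thesis using f by auto
qed

lemma frontier_polygon_height:
  assumes "finite H" "z \<in> frontier (polygon H)"
  shows "\<exists>L\<in>H. height L z = 0"
proof -
  have "z \<notin> polygon H" using assms open_polygon[OF assms(1)]
    by (auto simp: frontier_def interior_open)
  then obtain L where L: "L \<in> H" "height L z \<le> 0" by (auto simp: polygon_def not_less)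
  have "closed {y. 0 \<le> height L y}"
    unfolding height_def by (intro closed_Collect_le continuous_intros)
  moreover have "polygon H \<subseteq> {y. 0 \<le> height L y}" using L by (auto simp: polygon_def less_imp_le)
  ultimately have "closure (polygon H) \<subseteq> {y. 0 \<le> height L y}" by (rule closure_minimal[rotated])
  moreover have "z \<in> closure (polygon H)" using assms(2) by (simp add: frontier_def)
  ultimately show ?thesis using L by force
qed

lemma mirror_le_broken_path:
  assumes "norm (fst L) = 1" "height L z = 0"
  shows "norm (mirror L x - y) \<le> norm (x - z) + norm (z - y)"
proof -
  have "(norm (mirror L x - z))\<^sup>2 = (norm (x - z))\<^sup>2"
    using dist_mirror_square[OF assms(1)] assms(2) by simp
  then have "norm (mirror L x - z) = norm (x - z)" by simp
  moreover have "norm (mirror L x - y) \<le> norm (mirror L x - z) + norm (z - y)"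
    by (metis dist_norm dist_triangle)
  ultimately show ?thesis by simp
qed

lemma mirror_attained:
  assumes "norm (fst L) = 1" "0 < height L x" "0 < height L y"
  obtains z where "height L z = 0" "norm (x - z) + norm (z - y) = norm (mirror L x - y)"
proof -
  define t where "t = height L x / (height L x + height L y)"
  define z where "z = mirror L x + t *\<^sub>R (y - mirror L x)"
  have n: "fst L \<bullet> fst L = 1" using assms by (simp add: norm_eq_1)
  have t: "0 \<le> t" "t \<le> 1" using assms by (auto simp: t_def field_simps)
  have hm: "height L (mirror L x) = - height L x"
    using n by (simp add: height_def mirror_def inner_diff inner_add algebra_simps)
  have "height L z = height L (mirror L x) + t * (height L y - height L (mirror L x))"
    by (simp add: z_def height_def inner_diff inner_add algebra_simps)
  also have "\<dots> = 0" using assms unfolding hm t_def by (simp add: field_simps)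
  finally have h: "height L z = 0" .
  have "(norm (mirror L x - z))\<^sup>2 = (norm (x - z))\<^sup>2"
    using dist_mirror_square[OF assms(1)] h by simp
  then have "norm (x - z) = norm (mirror L x - z)" by simp
  also have "mirror L x - z = t *\<^sub>R (mirror L x - y)" by (simp add: z_def algebra_simps)
  finally have 1: "norm (x - z) = t * norm (mirror L x - y)" using t by simp
  have "z - y = (1 - t) *\<^sub>R (mirror L x - y)" by (simp add: z_def algebra_simps)
  then have 2: "norm (z - y) = (1 - t) * norm (mirror L x - y)" using t by simp
  show thesis by (rule that[OF h]) (simp add: 1 2 algebra_simps)
qed

text \<open>The comparison with \<open>r\<close> decouples into one condition per side. A boundary point lies on the line
  of some side, so its broken path is no shorter than the distance to the corresponding mirror image.
  Conversely, the shortest path via the line of a side touches it outside the open polygon, perhaps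
  beyond the side itself; but it then crosses the boundary on the way, and taking the crossing point as
  the intermediate point only shortens the path. Since the boundary is compact the supremum is
  attained, which is why the strict inequality survives.\<close>

lemma triangular_ratio_less_iff:
  assumes f: "finite H" and unit: "\<And>L. L \<in> H \<Longrightarrow> norm (fst L) = 1"
    and bd: "bounded (polygon H)" and x: "x \<in> polygon H" and y: "y \<in> polygon H"
    and r: "0 < r"
  shows "triangular_ratio (polygon H) x y < r \<longleftrightarrow>
         (\<forall>L\<in>H. norm (x - y) < r * norm (mirror L x - y))"
proof -
  let ?G = "polygon H"
  let ?F = "frontier ?G"
  let ?q = "\<lambda>z. norm (x - y) / (norm (x - z) + norm (z - y))"
  have cpt: "compact ?F" using bd by (simp add: compact_frontier_bounded)
  have "?G \<noteq> UNIV" using bd not_bounded_UNIV by auto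
  then have ne: "?F \<noteq> {}" using frontier_not_empty[of ?G] x by auto
  have op: "open ?G" using f by (rule open_polygon)
  have xF: "z \<in> ?F \<Longrightarrow> z \<noteq> x" for z using x op by (auto simp: frontier_def interior_open)
  have pos: "0 < norm (x - z) + norm (z - y)" if "z \<in> ?F" for z
    using xF[OF that] by (simp add: add_pos_nonneg)
  have cont: "continuous_on ?F ?q"
    by (intro continuous_intros) (use pos in force)
  obtain w where w: "w \<in> ?F" "\<And>z. z \<in> ?F \<Longrightarrow> ?q z \<le> ?q w"
    using continuous_attains_sup[OF cpt ne cont] by auto
  have "triangular_ratio ?G x y = ?q w"
    unfolding triangular_ratio_def using w by (intro cSup_eq_maximum) auto
  then have "triangular_ratio ?G x y < r \<longleftrightarrow> (\<forall>z\<in>?F. ?q z < r)"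
    using w by force
  also have "\<dots> \<longleftrightarrow> (\<forall>z\<in>?F. norm (x - y) < r * (norm (x - z) + norm (z - y)))"
    using pos by (intro ball_cong) (auto simp: field_simps)
  also have "\<dots> \<longleftrightarrow> (\<forall>L\<in>H. norm (x - y) < r * norm (mirror L x - y))"
  proof safe
    fix n c assume A: "\<forall>z\<in>?F. norm (x - y) < r * (norm (x - z) + norm (z - y))" "(n,c) \<in> H"
    let ?L = "(n,c)"
    have "0 < height ?L x" "0 < height ?L y" using x y A(2) by (auto simp: polygon_def)
    then obtain z where z: "height ?L z = 0" "norm (x - z) + norm (z - y) = norm (mirror ?L x - y)"
      using mirror_attained unit[OF A(2)] by metis
    have "z \<notin> ?G" using z A(2) by (force simp: polygon_def)
    then have "closed_segment x z \<inter> ?F \<noteq> {}"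
      using x by (intro connected_Int_frontier) auto
    then obtain v where v: "v \<in> closed_segment x z" "v \<in> ?F" by auto
    have "norm (x - v) + norm (v - z) = norm (x - z)"
      using v(1) by (metis between between_mem_segment dist_norm)
    moreover have "norm (v - y) \<le> norm (v - z) + norm (z - y)" by (metis dist_norm dist_triangle)
    ultimately have "norm (x - v) + norm (v - y) \<le> norm (mirror ?L x - y)" using z(2) by simp
    with A(1) v(2) r show "norm (x - y) < r * norm (mirror ?L x - y)"
      by (smt (verit) mult_left_mono)
  next
    fix z assume A: "\<forall>L\<in>H. norm (x - y) < r * norm (mirror L x - y)" "z \<in> ?F"
    obtain L where L: "L \<in> H" "height L z = 0" using frontier_polygon_height[OF f A(2)] by auto
    have "norm (mirror L x - y) \<le> norm (x - z) + norm (z - y)"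
      using mirror_le_broken_path unit L by auto
    with A(1) L r show "norm (x - y) < r * (norm (x - z) + norm (z - y))"
      by (smt (verit) mult_left_mono)
  qed
  finally show ?thesis .
qed

section \<open>Discs of Apollonius\<close>

definition disc_centre where
  "disc_centre r x L = x + (2 * r\<^sup>2 / (1 - r\<^sup>2) * height L x) *\<^sub>R fst L"

definition disc_radius where
  "disc_radius r x L = 2 * r / (1 - r\<^sup>2) * height L x"

text \<open>The condition from a single side says that the ratio of the distances from \<open>x\<close> and from its
  mirror image is less than \<open>r\<close>, which is the interior of a circle of Apollonius. Completing the square
  gives its centre and radius. The disc lies in the half-plane automatically, because \<open>r < 1\<close> makes
  its points closer to \<open>x\<close> than to the mirror image.\<close>

lemma mem_apollonian_disc_iff:
  assumes n: "norm (fst L) = 1" and h: "0 < height L x" and r: "0 < r" "r < 1"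
  shows "y \<in> ball (disc_centre r x L) (disc_radius r x L) \<longleftrightarrow>
         0 < height L y \<and> norm (x - y) < r * norm (mirror L x - y)"
proof -
  have nn: "fst L \<bullet> fst L = 1" using n by (simp add: norm_eq_1)
  have r2: "0 < 1 - r\<^sup>2" using r by (simp add: power_less_one_iff)
  define k where "k = 1 - r\<^sup>2"
  define u where "u = y - x"
  have k: "0 < k" and rk: "r\<^sup>2 = 1 - k" using r2 by (auto simp: k_def)
  have hy: "height L y = height L x + fst L \<bullet> u"
    by (simp add: height_def u_def inner_diff)
  have R: "0 \<le> disc_radius r x L" using h r r2 by (simp add: disc_radius_def)
  have eq: "(norm (disc_centre r x L - y))\<^sup>2 = (norm (x - y))\<^sup>2 - 4 * r\<^sup>2 / k * height L x * (fst L \<bullet> u)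
            + (2 * r\<^sup>2 / k * height L x)\<^sup>2"
  proof -
    have "disc_centre r x L - y = (2 * r\<^sup>2 / k * height L x) *\<^sub>R fst L - u"
      by (simp add: disc_centre_def u_def k_def)
    moreover have "(norm (s *\<^sub>R fst L - u))\<^sup>2 = (norm u)\<^sup>2 - 2 * s * (fst L \<bullet> u) + s\<^sup>2" for s
      unfolding power2_norm_eq_inner using nn
      by (simp add: inner_diff inner_commute algebra_simps power2_eq_square)
    ultimately have "(norm (disc_centre r x L - y))\<^sup>2 = (norm u)\<^sup>2
        - 2 * (2 * r\<^sup>2 / k * height L x) * (fst L \<bullet> u) + (2 * r\<^sup>2 / k * height L x)\<^sup>2" by metis
    moreover have "norm u = norm (x - y)" by (simp add: u_def norm_minus_commute)
    ultimately show ?thesis by simp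
  qed
  have R2: "(disc_radius r x L)\<^sup>2 - (2 * r\<^sup>2 / k * height L x)\<^sup>2 = 4 * r\<^sup>2 / k * (height L x)\<^sup>2"
  proof -
    define w where "w = height L x / k"
    have hw: "height L x = k * w" using k by (simp add: w_def)
    have "disc_radius r x L = 2 * r * w"
      using k by (simp add: disc_radius_def k_def[symmetric] hw)
    moreover have "2 * r\<^sup>2 / k * height L x = 2 * r\<^sup>2 * w"
      "4 * r\<^sup>2 / k * (height L x)\<^sup>2 = 4 * r\<^sup>2 * k * w\<^sup>2"
      using k by (simp_all add: hw power2_eq_square)
    ultimately show ?thesis unfolding k_def by (simp add: power2_eq_square algebra_simps)
  qed
  have "y \<in> ball (disc_centre r x L) (disc_radius r x L) \<longleftrightarrow>
        (norm (disc_centre r x L - y))\<^sup>2 < (disc_radius r x L)\<^sup>2"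
    unfolding mem_ball dist_norm using R
    by (metis norm_ge_zero power2_less_imp_less power_strict_mono zero_less_numeral)
  also have "\<dots> \<longleftrightarrow> (norm (x - y))\<^sup>2 < 4 * r\<^sup>2 / k * height L x * (height L x + fst L \<bullet> u)"
    using R2 unfolding eq by (auto simp: algebra_simps power2_eq_square add_divide_distrib)
  also have "\<dots> \<longleftrightarrow> k * (norm (x - y))\<^sup>2 < 4 * r\<^sup>2 * height L x * height L y"
    using k unfolding hy by (simp add: field_simps)
  finally have disc: "y \<in> ball (disc_centre r x L) (disc_radius r x L) \<longleftrightarrow>
     k * (norm (x - y))\<^sup>2 < 4 * r\<^sup>2 * height L x * height L y" .
  have "k * (norm (x - y))\<^sup>2 < 4 * r\<^sup>2 * height L x * height L y \<longleftrightarrow>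
     (norm (x - y))\<^sup>2 < (r * norm (mirror L x - y))\<^sup>2"
    unfolding power_mult_distrib dist_mirror_square[OF n] k_def by (simp add: algebra_simps)
  also have "\<dots> \<longleftrightarrow> norm (x - y) < r * norm (mirror L x - y)"
    using r by (metis norm_ge_zero power2_less_imp_less power_strict_mono mult_nonneg_nonneg less_imp_le zero_less_numeral)
  finally have ratio: "k * (norm (x - y))\<^sup>2 < 4 * r\<^sup>2 * height L x * height L y \<longleftrightarrow>
     norm (x - y) < r * norm (mirror L x - y)" .
  have "0 < height L y" if "k * (norm (x - y))\<^sup>2 < 4 * r\<^sup>2 * height L x * height L y"
  proof -
    have "0 < 4 * r\<^sup>2 * height L x * height L y" using that k
      by (smt (verit) mult_nonneg_nonneg zero_le_power2)
    moreover have "0 < 4 * r\<^sup>2 * height L x" using h r by simp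
    ultimately show ?thesis by (rule zero_less_mult_pos)
  qed
  then show ?thesis using disc ratio by auto
qed

text \<open>The condition for the Apollonian disc of one side to be contained in that of another, where
  \<open>u\<close> and \<open>v\<close> are the distances of \<open>x\<close> to the two sides and \<open>k\<close> is the cosine of the angle between
  their unit normals. The square root is the distance between the feet of the two perpendiculars.\<close>

definition nests :: "real \<Rightarrow> real \<Rightarrow> real \<Rightarrow> real \<Rightarrow> bool" where
  "nests k r u v \<longleftrightarrow> r * sqrt (u\<^sup>2 + v\<^sup>2 - 2 * k * u * v) \<le> v - u"

text \<open>The distance between the two centres is \<open>r\<close> times the distance between the feet of the perpendiculars
  and the radii are the heights, both up to the same factor \<open>2 * r / (1 - r\<^sup>2)\<close>. Containment is the
  comparison of the distance of the centres with the difference of the radii.\<close>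

lemma disc_subset_iff:
  assumes n: "norm (fst L) = 1" "norm (fst M) = 1" and h: "0 < height L x" and r: "0 < r" "r < 1"
  shows "ball (disc_centre r x L) (disc_radius r x L) \<subseteq> ball (disc_centre r x M) (disc_radius r x M)
     \<longleftrightarrow> nests (fst L \<bullet> fst M) r (height L x) (height M x)"
proof -
  define \<rho> where "\<rho> = 2 * r / (1 - r\<^sup>2)"
  have "0 < 1 - r\<^sup>2" using r by (simp add: power_less_one_iff)
  then have \<rho>: "0 < \<rho>" using r by (simp add: \<rho>_def)
  define u v N where "u = height L x" and "v = height M x" and "N = norm (u *\<^sub>R fst L - v *\<^sub>R fst M)"
  have "N\<^sup>2 = u\<^sup>2 + v\<^sup>2 - 2 * (fst L \<bullet> fst M) * u * v"
    using n unfolding N_def power2_norm_eq_inner norm_eq_1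
    by (simp add: inner_diff inner_commute power2_eq_square algebra_simps)
  then have N: "N = sqrt (u\<^sup>2 + v\<^sup>2 - 2 * (fst L \<bullet> fst M) * u * v)"
    by (metis N_def norm_ge_zero real_sqrt_unique)
  have "disc_centre r x L - disc_centre r x M = (\<rho> * r) *\<^sub>R (u *\<^sub>R fst L - v *\<^sub>R fst M)"
    by (simp add: disc_centre_def u_def v_def \<rho>_def power2_eq_square algebra_simps)
  then have d: "dist (disc_centre r x L) (disc_centre r x M) = \<rho> * (r * N)"
    using \<rho> r by (simp add: dist_norm N_def)
  have R: "disc_radius r x L = \<rho> * u" "disc_radius r x M = \<rho> * v"
    by (simp_all add: disc_radius_def \<rho>_def u_def v_def)
  have "0 < \<rho> * u" using \<rho> h by (simp add: u_def)
  then have "ball (disc_centre r x L) (disc_radius r x L) \<subseteq> ball (disc_centre r x M) (disc_radius r x M)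
     \<longleftrightarrow> \<rho> * (r * N) + \<rho> * u \<le> \<rho> * v"
    unfolding ball_subset_ball_iff d R by auto
  also have "\<dots> \<longleftrightarrow> \<rho> * (r * N + u) \<le> \<rho> * v" by (simp add: algebra_simps)
  also have "\<dots> \<longleftrightarrow> r * N + u \<le> v" using \<rho> by (rule mult_le_cancel_left_pos)
  also have "\<dots> \<longleftrightarrow> r * N \<le> v - u" by auto
  finally show ?thesis by (simp add: nests_def N u_def v_def)
qed

section \<open>Smoothness and corners\<close>

text \<open>This is the only obstruction to smoothness that is needed. If the curve stays on one side of the
  line through \<open>p\<close> with normal \<open>m\<close>, then the inner product with \<open>m\<close> has a minimum along the
  parametrization at \<open>p\<close>, so the velocity there is orthogonal to \<open>m\<close>. A nonzero vector in the plane is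
  not orthogonal to two independent normals.\<close>

lemma smooth_closed_curve_no_corner:
  assumes S: "smooth_closed_curve S" and p: "p \<in> S"
    and m: "\<And>q. q \<in> S \<Longrightarrow> 0 \<le> m \<bullet> (q - p)"
    and n: "\<And>q. q \<in> S \<Longrightarrow> 0 \<le> n \<bullet> (q - p)"
  shows "m $ 1 * n $ 2 = m $ 2 * n $ 1"
proof -
  obtain D :: "nat \<Rightarrow> real \<Rightarrow> real^2" where
    D: "\<And>k t. (D k has_vector_derivative D (Suc k) t) (at t)"
    and reg: "\<And>t. D 1 t \<noteq> 0" and S_eq: "S = range (D 0)"
    using S by (auto simp: smooth_closed_curve_def)
  obtain t where t: "p = D 0 t" using p S_eq by auto
  have tangent: "k \<bullet> D 1 t = 0" if k: "\<And>q. q \<in> S \<Longrightarrow> 0 \<le> k \<bullet> (q - p)" for k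
  proof -
    have "((\<lambda>s. k \<bullet> (D 0 s - p)) has_vector_derivative k \<bullet> D 1 t) (at t)"
      using D[of 0 t] by (auto simp: has_vector_derivative_def inner_diff intro!: derivative_eq_intros)
    then have "DERIV (\<lambda>s. k \<bullet> (D 0 s - p)) t :> k \<bullet> D 1 t"
      by (simp add: has_real_derivative_iff_has_vector_derivative)
    then show ?thesis
      by (rule DERIV_local_min[of _ _ _ 1]) (use k S_eq in \<open>auto simp: t\<close>)
  qed
  define v where "v = D 1 t"
  have "m $ 1 * v $ 1 + m $ 2 * v $ 2 = 0" "n $ 1 * v $ 1 + n $ 2 * v $ 2 = 0"
    using tangent[OF m] tangent[OF n] by (simp_all add: inner_vec_def sum_2 v_def)
  moreover have "v $ 1 \<noteq> 0 \<or> v $ 2 \<noteq> 0"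
    using reg[of t] by (auto simp: v_def vec_eq_iff forall_2)
  ultimately show ?thesis by algebra
qed

lemma smooth_closed_curve_sphere:
  fixes c :: "real^2"
  assumes R: "0 < R"
  shows "smooth_closed_curve (sphere c R)"
proof -
  define e where "e \<theta> = cos \<theta> *\<^sub>R axis 1 1 + sin \<theta> *\<^sub>R (axis 2 1 :: real^2)" for \<theta> :: real
  have e_nth: "e \<theta> $ 1 = cos \<theta>" "e \<theta> $ 2 = sin \<theta>" for \<theta> by (auto simp: e_def axis_def)
  (* Each derivative of the circular motion adds a quarter turn to the phase. *)
  define D where "D k t = (if k = 0 then c else 0) +
      (R * (2 * pi) ^ k) *\<^sub>R e (2 * pi * t + real k * (pi / 2))" for k t
  have e_deriv: "((\<lambda>t. e (2 * pi * t + b)) has_vector_derivative (2 * pi) *\<^sub>R e (2 * pi * t + b + pi / 2)) (at t)" for b t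
    unfolding e_def has_vector_derivative_def
    by (auto intro!: derivative_eq_intros simp: fun_eq_iff cos_add sin_add scaleR_add_right algebra_simps)
  have deriv: "(D k has_vector_derivative D (Suc k) t) (at t)" for k t
  proof -
    have "((\<lambda>t. (if k = 0 then c else 0) + (R * (2 * pi) ^ k) *\<^sub>R e (2 * pi * t + real k * (pi / 2)))
       has_vector_derivative 0 + (R * (2 * pi) ^ k) *\<^sub>R ((2 * pi) *\<^sub>R e (2 * pi * t + real k * (pi / 2) + pi / 2))) (at t)"
      by (intro has_vector_derivative_add has_vector_derivative_const e_deriv
        bounded_linear.has_vector_derivative[OF bounded_linear_scaleR_right])
    moreover have "0 + (R * (2 * pi) ^ k) *\<^sub>R ((2 * pi) *\<^sub>R e (2 * pi * t + real k * (pi / 2) + pi / 2)) = D (Suc k) t"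
    proof -
      have "2 * pi * t + real k * (pi / 2) + pi / 2 = 2 * pi * t + real (Suc k) * (pi / 2)"
        by (simp add: field_simps)
      then show ?thesis unfolding D_def by (simp only:) simp
    qed
    ultimately show ?thesis by (simp add: D_def[abs_def])
  qed
  have D0: "D 0 t = c + R *\<^sub>R e (2 * pi * t)" for t by (simp add: D_def)
  have norm_e: "norm (e \<theta>) = 1" for \<theta>
    by (simp add: norm_vec_def L2_set_def sum_2 e_nth)
  have "D 0 (t + 1) = D 0 t" for t by (simp add: D0 e_def distrib_left)
  moreover have "D 1 t \<noteq> 0" for t using norm_e[of "2 * pi * t + pi / 2"] R by (auto simp: D_def)
  moreover have "inj_on (D 0) {0..<1}"
  proof (rule inj_onI)
    fix s t :: real assume st: "s \<in> {0..<1}" "t \<in> {0..<1}" "D 0 s = D 0 t"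
    then have "e (2 * pi * s) = e (2 * pi * t)" using R by (simp add: D0)
    then obtain n :: int where "2 * pi * s = 2 * pi * t + 2 * pi * n"
      using sin_cos_eq_iff[of "2 * pi * s" "2 * pi * t"] by (metis e_nth)
    then have "2 * pi * s = 2 * pi * (t + n)" by (simp add: algebra_simps)
    then have "s = t + n" by simp
    moreover from this st have "real_of_int n < 1" "- 1 < real_of_int n" by auto
    then have "n = 0" by linarith
    ultimately show "s = t" by simp
  qed
  moreover have "sphere c R = range (D 0)"
  proof safe
    fix t show "D 0 t \<in> sphere c R" using R norm_e by (simp add: D0 dist_norm)
  next
    fix y assume "y \<in> sphere c R"
    define z where "z = (1 / R) *\<^sub>R (y - c)"
    have y: "y = c + R *\<^sub>R z" using R by (simp add: z_def)
    have "norm z = 1" using R \<open>y \<in> sphere c R\<close> by (simp add: z_def dist_norm norm_minus_commute)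
    then have "(z $ 1)\<^sup>2 + (z $ 2)\<^sup>2 = 1" by (simp add: norm_vec_def L2_set_def sum_2)
    then obtain \<theta> where "z $ 1 = cos \<theta>" "z $ 2 = sin \<theta>" by (rule sincos_total_2pi)
    then have "z = e \<theta>" by (simp add: vec_eq_iff forall_2 e_nth)
    then have "y = D 0 (\<theta> / (2 * pi))" by (simp add: D0 y)
    then show "y \<in> range (D 0)" by blast
  qed
  ultimately show ?thesis unfolding smooth_closed_curve_def using deriv by blast
qed

lemma frontier_Inter_open_subset:
  assumes "finite B" "p \<in> frontier (\<Inter>B)" "\<And>U. U \<in> B \<Longrightarrow> open U"
  shows "\<exists>U\<in>B. p \<in> frontier U"
proof -
  have "open (\<Inter>B)" using assms by auto
  then have "p \<in> closure (\<Inter>B)" "p \<notin> \<Inter>B" using assms(2) by (auto simp: frontier_def interior_open)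
  then obtain U where U: "U \<in> B" "p \<notin> U" by auto
  moreover have "p \<in> closure U" using \<open>p \<in> closure (\<Inter>B)\<close> closure_mono[of "\<Inter>B" U] U by auto
  ultimately show ?thesis using assms(3)[of U] by (auto simp: frontier_def interior_open)
qed

text \<open>If the centres are collinear with the common boundary point \<open>p\<close>, then their distance is the sum or the
  absolute difference of the radii. The sum would mean external tangency, excluded by the common
  point \<open>x\<close>; the difference means internal tangency.\<close>

lemma tangent_balls_nested:
  fixes p :: "real^2"
  assumes R: "dist c p = R" "dist c' p = R'" "0 < R" "0 < R'"
    and x: "x \<in> ball c R" "x \<in> ball c' R'"
    and coll: "(c - p) $ 1 * (c' - p) $ 2 = (c - p) $ 2 * (c' - p) $ 1"
  shows "ball c R \<subseteq> ball c' R' \<or> ball c' R' \<subseteq> ball c R"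
proof -
  define u where "u = c - p" define v where "v = c' - p"
  have uu: "u \<bullet> u = R\<^sup>2" and vv: "v \<bullet> v = R'\<^sup>2"
    using R by (auto simp: u_def v_def dist_norm power2_norm_eq_inner)
  have "(u \<bullet> v)\<^sup>2 = (u \<bullet> u) * (v \<bullet> v)"
    using coll unfolding u_def[symmetric] v_def[symmetric]
    by (simp add: inner_vec_def sum_2) algebra
  then have "(u \<bullet> v)\<^sup>2 = (R * R')\<^sup>2" by (simp add: uu vv power_mult_distrib)
  then consider "u \<bullet> v = R * R'" | "u \<bullet> v = - (R * R')" by (auto simp: power2_eq_iff)
  moreover have dd: "(dist c c')\<^sup>2 = R\<^sup>2 + R'\<^sup>2 - 2 * (u \<bullet> v)"
  proof -
    have "c - c' = u - v" by (simp add: u_def v_def)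
    then show ?thesis unfolding dist_norm power2_norm_eq_inner
      by (simp add: inner_diff uu vv inner_commute)
  qed
  moreover have "dist c c' < R + R'"
    using x dist_triangle[of c c' x] by (simp add: dist_commute)
  ultimately have "u \<bullet> v = R * R'"
  proof cases
    case 2
    then have "(dist c c')\<^sup>2 = (R + R')\<^sup>2" using dd by (simp add: power2_sum)
    then have "dist c c' = R + R'" using R by (smt (verit) power2_eq_imp_eq zero_le_dist)
    with \<open>dist c c' < R + R'\<close> show ?thesis by simp
  qed
  then have "(dist c c')\<^sup>2 = (R - R')\<^sup>2" using dd by (simp add: power2_diff)
  then have "dist c c' = \<bar>R - R'\<bar>" by (metis abs_of_nonneg real_sqrt_abs zero_le_dist)
  then show ?thesis unfolding ball_subset_ball_iff by (auto simp: dist_commute)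
qed

lemma cball_supporting_line:
  assumes "q \<in> cball c (dist c p)"
  shows "0 \<le> (c - p) \<bullet> (q - p)"
proof -
  have "(norm (c - q))\<^sup>2 \<le> (norm (c - p))\<^sup>2"
    using assms by (intro power_mono) (auto simp: dist_norm)
  moreover have "c - q = (c - p) - (q - p)" by simp
  then have "(norm (c - q))\<^sup>2 = (norm (c - p))\<^sup>2 - 2 * ((c - p) \<bullet> (q - p)) + (norm (q - p))\<^sup>2"
    unfolding power2_norm_eq_inner by (simp only:) (simp add: inner_diff inner_commute)
  moreover have "0 \<le> (norm (q - p))\<^sup>2" by simp
  ultimately show ?thesis by linarith
qed

text \<open>Discs that contain another disc of the family do not affect the intersection, so only the minimal
  ones matter. The boundary of the intersection is connected, being the boundary of a bounded convex open
  set in the plane, and it is covered by its closed intersections with the finitely many minimal circles.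
  If two of these pieces met, the common point would be a corner unless the two circles
  were tangent, and tangent circles whose discs overlap are nested, against minimality. So the pieces are
  disjoint and, by connectedness, the whole boundary lies on one circle; its disc then cannot leave
  the intersection.\<close>

lemma smooth_frontier_Inter_balls:
  fixes B :: "(real^2) set set"
  assumes fin: "finite B" "B \<noteq> {}"
    and balls: "\<And>U. U \<in> B \<Longrightarrow> \<exists>c R. U = ball c R"
    and x: "x \<in> \<Inter>B"
    and smooth: "smooth_closed_curve (frontier (\<Inter>B))"
  shows "\<Inter>B \<in> B"
proof -
  define M where "M = {U \<in> B. \<forall>V\<in>B. V \<subseteq> U \<longrightarrow> V = U}"
  define K where "K = \<Inter>B"
  have M: "finite M" "M \<subseteq> B" using fin by (auto simp: M_def)
  have below: "\<exists>V\<in>M. V \<subseteq> U" if "U \<in> B" for U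
  proof -
    obtain V where "V \<in> B" "V \<subseteq> U" "\<forall>W\<in>B. W \<subseteq> V \<longrightarrow> V = W"
      using finite_has_minimal2[OF fin(1) \<open>U \<in> B\<close>] by blast
    then show ?thesis unfolding M_def by blast
  qed
  have "\<Inter>M \<subseteq> U" if "U \<in> B" for U using below[OF that] by blast
  then have KM: "K = \<Inter>M" using M by (auto simp: K_def)
  have op: "open U" "convex U" "bounded U" if "U \<in> B" for U using balls[OF that] by auto
  have K: "open K" "convex K" "x \<in> K"
    using op fin x unfolding K_def by (auto intro!: convex_Inter open_Inter)
  obtain U0 where "U0 \<in> B" using fin by auto
  then have bdK: "bounded K" using op(3) bounded_subset[of U0 K] by (auto simp: K_def)
  have "interior K \<noteq> {}" using K by (auto simp: interior_open)
  have conn: "connected (frontier K)"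
  proof -
    have "aff_dim K = 2" using K aff_dim_open[of K] by auto
    then have "connected (rel_frontier K)" using K bdK by (intro connected_sphere_gen) auto
    then show ?thesis using \<open>interior K \<noteq> {}\<close> by (simp add: rel_frontier_nonempty_interior)
  qed
  have "K \<noteq> UNIV" using bdK not_bounded_UNIV by auto
  then have ne: "frontier K \<noteq> {}" using K frontier_not_empty[of K] by auto
  have disjoint: "U = V" if U: "U \<in> M" "p \<in> frontier U" and V: "V \<in> M" "p \<in> frontier V"
    and p: "p \<in> frontier K" for U V p
  proof -
    obtain c R where cR: "U = ball c R" using balls U M by blast
    obtain c' R' where cR': "V = ball c' R'" using balls V M by blast
    have xU: "x \<in> U" "x \<in> V" using x U V M by auto
    have pos: "0 < R" "0 < R'" using xU cR cR' by (auto intro: le_less_trans[OF zero_le_dist])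
    have d: "dist c p = R" "dist c' p = R'" using U V pos by (auto simp: cR cR')
    have K_in: "q \<in> closure W" if "q \<in> frontier K" "W \<in> M" for q W
      using that closure_mono[of K W] KM by (auto simp: frontier_def)
    have "(c - p) $ 1 * (c' - p) $ 2 = (c - p) $ 2 * (c' - p) $ 1"
    proof (rule smooth_closed_curve_no_corner[OF smooth])
      show "p \<in> frontier (\<Inter>B)" using p by (simp add: K_def)
      fix q assume "q \<in> frontier (\<Inter>B)"
      then have "q \<in> closure U" "q \<in> closure V" using K_in U V by (auto simp: K_def)
      then show "0 \<le> (c - p) \<bullet> (q - p)" "0 \<le> (c' - p) \<bullet> (q - p)"
        using pos d by (auto intro!: cball_supporting_line simp: cR cR')
    qed
    then have "U \<subseteq> V \<or> V \<subseteq> U"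
      using tangent_balls_nested[OF d pos] xU unfolding cR cR' by blast
    then show ?thesis using U V by (auto simp: M_def)
  qed
  obtain p where p: "p \<in> frontier K" using ne by auto
  have cover: "\<exists>U\<in>M. q \<in> frontier U" if "q \<in> frontier K" for q
  proof (rule frontier_Inter_open_subset[OF M(1)])
    show "q \<in> frontier (\<Inter>M)" using that by (simp add: KM)
  qed (use op(1) M in auto)
  obtain U where U: "U \<in> M" "p \<in> frontier U" using cover[OF p] by auto
  have "frontier K \<subseteq> frontier U"
  proof (rule ccontr)
    assume outside: "\<not> frontier K \<subseteq> frontier U"
    let ?W = "\<Union>V\<in>M - {U}. frontier V"
    have "closed (frontier U)" "closed ?W" using M by (auto intro!: closed_UN)
    moreover have "frontier K \<subseteq> frontier U \<union> ?W" using cover by blast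
    moreover have "frontier U \<inter> ?W \<inter> frontier K = {}" using disjoint U by blast
    moreover have "frontier U \<inter> frontier K \<noteq> {}" using U p by auto
    moreover have "?W \<inter> frontier K \<noteq> {}" using outside cover by blast
    ultimately show False using connected_closedD[OF conn, of "frontier U" ?W] by argo
  qed
  have "U \<subseteq> K"
  proof (rule ccontr)
    assume "\<not> U \<subseteq> K"
    moreover have "x \<in> U" using K U by (auto simp: KM)
    ultimately have "U \<inter> frontier K \<noteq> {}"
      using K op U M by (intro connected_Int_frontier convex_connected) auto
    moreover have "U \<inter> frontier U = {}" using op U M by (auto simp: frontier_def interior_open)
    ultimately show False using \<open>frontier K \<subseteq> frontier U\<close> by auto
  qed
  moreover have "K \<subseteq> U" using U KM by auto
  ultimately show ?thesis using U M by (auto simp: K_def)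
qed

section \<open>Smooth balls in convex polygons\<close>

lemma triangular_ratio_ball_polygon:
  assumes "finite H" "\<And>L. L \<in> H \<Longrightarrow> norm (fst L) = 1" "H \<noteq> {}"
    and "bounded (polygon H)" "x \<in> polygon H" "0 < r" "r < 1"
  shows "triangular_ratio_ball (polygon H) x r =
         (\<Inter>L\<in>H. ball (disc_centre r x L) (disc_radius r x L))"
proof -
  have h: "0 < height L x" if "L \<in> H" for L using assms(5) that by (auto simp: polygon_def)
  have "y \<in> triangular_ratio_ball (polygon H) x r \<longleftrightarrow>
     (\<forall>L\<in>H. 0 < height L y \<and> norm (x - y) < r * norm (mirror L x - y))" for y
    using triangular_ratio_less_iff[OF assms(1,2,4,5) _ assms(6), of y]
    by (auto simp: triangular_ratio_ball_def polygon_def)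
  then show ?thesis
    using mem_apollonian_disc_iff[OF assms(2) h assms(6,7)] by blast
qed

text \<open>Two points of the polygon lie on the same side of every mirror line, so each is strictly closer to
  the other than to the mirror image of the other.\<close>

lemma triangular_ratio_ball_polygon_ge_1:
  assumes "finite H" "\<And>L. L \<in> H \<Longrightarrow> norm (fst L) = 1"
    and "bounded (polygon H)" "x \<in> polygon H" "1 \<le> r"
  shows "triangular_ratio_ball (polygon H) x r = polygon H"
proof -
  have "norm (x - y) < r * norm (mirror L x - y)" if y: "y \<in> polygon H" and L: "L \<in> H" for y L
  proof -
    have "0 < 4 * height L x * height L y" using y L assms(4) by (auto simp: polygon_def)
    then have "(norm (x - y))\<^sup>2 < (norm (mirror L x - y))\<^sup>2"
      using dist_mirror_square[OF assms(2)[OF L], of x y] by linarith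
    then have "norm (x - y) < norm (mirror L x - y)" by (rule power2_less_imp_less) simp
    also have "\<dots> \<le> r * norm (mirror L x - y)" using assms(5) by (simp add: mult_le_cancel_right1)
    finally show ?thesis .
  qed
  then show ?thesis
    using triangular_ratio_less_iff[OF assms(1,2,3,4), of _ r] assms(5)
    by (auto simp: triangular_ratio_ball_def)
qed

lemma convex_closed_polygon: "convex {y. \<forall>L\<in>H. 0 \<le> height L y}"
proof -
  have "{y. \<forall>L\<in>H. 0 \<le> height L y} = (\<Inter>L\<in>H. {y. - snd L \<le> fst L \<bullet> y})" by (force simp: height_def)
  then show ?thesis by (auto intro!: convex_INT convex_halfspace_ge)
qed

lemma interior_closed_polygon:
  assumes "finite H" "\<And>L. L \<in> H \<Longrightarrow> norm (fst L) = 1"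
  shows "interior {y. \<forall>L\<in>H. 0 \<le> height L y} = polygon H"
proof (rule subset_antisym)
  show "polygon H \<subseteq> interior {y. \<forall>L\<in>H. 0 \<le> height L y}"
    using open_polygon[OF assms(1)] by (intro interior_maximal) (auto simp: polygon_def less_imp_le)
  show "interior {y. \<forall>L\<in>H. 0 \<le> height L y} \<subseteq> polygon H"
  proof
    fix y assume y: "y \<in> interior {y. \<forall>L\<in>H. 0 \<le> height L y}"
    have "0 < height L y" if L: "L \<in> H" for L
    proof -
      have "y \<in> interior {y. 0 \<le> height L y}"
        using y interior_mono[of "{y. \<forall>L\<in>H. 0 \<le> height L y}" "{y. 0 \<le> height L y}"] L by auto
      also have "{y. 0 \<le> height L y} = {y. - snd L \<le> fst L \<bullet> y}" by (auto simp: height_def)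
      also have "interior \<dots> = {y. - snd L < fst L \<bullet> y}"
        using assms(2)[OF L] by (intro interior_halfspace_ge) auto
      finally show ?thesis by (simp add: height_def)
    qed
    then show "y \<in> polygon H" by (simp add: polygon_def)
  qed
qed

lemma frontier_polygonI:
  assumes H: "finite H" "\<And>L. L \<in> H \<Longrightarrow> norm (fst L) = 1" and ne: "polygon H \<noteq> {}"
    and p: "\<And>L. L \<in> H \<Longrightarrow> 0 \<le> height L p" and L0: "L0 \<in> H" "height L0 p = 0"
  shows "p \<in> frontier (polygon H)"
proof -
  let ?S = "{y. \<forall>L\<in>H. 0 \<le> height L y}"
  have "closure (polygon H) = closure ?S"
    using convex_closure_interior[OF convex_closed_polygon, of H] interior_closed_polygon[OF H] ne by auto
  then have "p \<in> closure (polygon H)" using p closure_subset[of ?S] by auto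
  moreover have "p \<notin> polygon H" using L0 by (force simp: polygon_def)
  ultimately show ?thesis using open_polygon[OF H(1)] by (simp add: frontier_def interior_open)
qed

text \<open>For \<open>r \<ge> 1\<close> the nesting condition reverses the triangle inequality between the heights and the feet
  of the perpendiculars, so it holds only in the case of equality. This extends the criterion for smooth balls,
  which is about discs for \<open>r < 1\<close>, to all radii.\<close>

lemma nests_unit_eq:
  assumes "norm n = 1" "norm m = 1" "0 < u" "0 < v" "1 \<le> r" "nests (n \<bullet> m) r u v"
  shows "n = (m :: real^2)"
proof -
  define k where "k = n \<bullet> m"
  have k: "k \<le> 1" using norm_cauchy_schwarz[of n m] assms by (simp add: k_def)
  have uv: "0 < u * v" using assms by simp
  have q: "u\<^sup>2 + v\<^sup>2 - 2 * k * u * v = (v - u)\<^sup>2 + 2 * (1 - k) * (u * v)"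
    by (simp add: power2_eq_square algebra_simps)
  have q0: "0 \<le> 2 * (1 - k) * (u * v)" using k uv by simp
  let ?s = "sqrt (u\<^sup>2 + v\<^sup>2 - 2 * k * u * v)"
  have "0 \<le> ?s" using q q0 by simp
  then have "?s \<le> r * ?s" using assms(5) mult_right_mono[of 1 r ?s] by simp
  then have "?s \<le> v - u" using assms(6) by (simp add: nests_def k_def)
  then have "?s\<^sup>2 \<le> (v - u)\<^sup>2" using q q0 by (intro power_mono) auto
  then have "2 * (1 - k) * (u * v) \<le> 0" using q q0 by simp
  then have "k = 1" using k assms(3,4) by (auto simp: mult_le_0_iff)
  then have "(norm (n - m))\<^sup>2 = 0"
    unfolding power2_norm_eq_inner using assms(1,2)
    by (simp add: k_def inner_diff inner_commute norm_eq_1)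
  then show ?thesis by simp
qed

text \<open>For \<open>r < 1\<close> the ball is an intersection of discs, so it is smooth exactly when one of them is contained
  in all the others. For \<open>r \<ge> 1\<close> the ball is the whole polygon, which has a corner at the vertex \<open>p\<close>, and
  the nesting conditions fail because the two sides at \<open>p\<close> have different normals.\<close>

theorem smooth_ball_polygon_iff:
  assumes H: "finite H" "\<And>L. L \<in> H \<Longrightarrow> norm (fst L) = 1"
    and bd: "bounded (polygon H)" and x: "x \<in> polygon H" and r: "0 < r"
    and vertex: "L1 \<in> H" "L2 \<in> H" "height L1 p = 0" "height L2 p = 0"
      "\<And>L. L \<in> H \<Longrightarrow> 0 \<le> height L p"
      "fst L1 $ 1 * fst L2 $ 2 \<noteq> fst L1 $ 2 * fst L2 $ 1"
  shows "smooth_ball (polygon H) x r \<longleftrightarrow>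
     (\<exists>L\<in>H. \<forall>M\<in>H. nests (fst L \<bullet> fst M) r (height L x) (height M x))"
proof (cases "r < 1")
  case True
  let ?D = "\<lambda>L. ball (disc_centre r x L) (disc_radius r x L)"
  have ne: "H \<noteq> {}" using vertex by auto
  have h: "0 < height L x" if "L \<in> H" for L using x that by (auto simp: polygon_def)
  have ball_eq: "triangular_ratio_ball (polygon H) x r = \<Inter>(?D ` H)"
    using triangular_ratio_ball_polygon[OF H ne bd x r True] by simp
  have r2: "0 < 1 - r\<^sup>2" using r True by (simp add: power_less_one_iff)
  have nest: "?D L \<subseteq> ?D M \<longleftrightarrow> nests (fst L \<bullet> fst M) r (height L x) (height M x)"
    if "L \<in> H" "M \<in> H" for L M
    using disc_subset_iff[OF H(2) H(2) h r True] that by blast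
  have "smooth_ball (polygon H) x r \<longleftrightarrow> (\<exists>L\<in>H. \<forall>M\<in>H. ?D L \<subseteq> ?D M)"
  proof
    assume "smooth_ball (polygon H) x r"
    then have smooth: "smooth_closed_curve (frontier (\<Inter>(?D ` H)))" by (simp add: smooth_ball_def ball_eq)
    have "mirror L x - x = - ((2 * height L x) *\<^sub>R fst L)" for L by (simp add: mirror_def)
    then have "0 < r * norm (mirror L x - x)" if "L \<in> H" for L
      using h[OF that] H(2)[OF that] r by simp
    then have "x \<in> ?D L" if "L \<in> H" for L
      using mem_apollonian_disc_iff[OF H(2) h r True, of L x] h that by simp
    then have "x \<in> \<Inter>(?D ` H)" by blast
    then have "\<Inter>(?D ` H) \<in> ?D ` H"
      by (intro smooth_frontier_Inter_balls[OF _ _ _ _ smooth]) (use H ne in auto)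
    then obtain L where "L \<in> H" "\<Inter>(?D ` H) = ?D L" by (rule imageE)
    then show "\<exists>L\<in>H. \<forall>M\<in>H. ?D L \<subseteq> ?D M" by blast
  next
    assume "\<exists>L\<in>H. \<forall>M\<in>H. ?D L \<subseteq> ?D M"
    then obtain L where L: "L \<in> H" "\<forall>M\<in>H. ?D L \<subseteq> ?D M" by auto
    then have "\<Inter>(?D ` H) = ?D L" by blast
    moreover have "0 < disc_radius r x L" using r r2 h[OF L(1)] by (simp add: disc_radius_def)
    ultimately show "smooth_ball (polygon H) x r"
      by (simp add: smooth_ball_def ball_eq frontier_ball smooth_closed_curve_sphere)
  qed
  also have "\<dots> \<longleftrightarrow> (\<exists>L\<in>H. \<forall>M\<in>H. nests (fst L \<bullet> fst M) r (height L x) (height M x))"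
    using nest by blast
  finally show ?thesis .
next
  case False
  have h: "0 < height L x" if "L \<in> H" for L using x that by (auto simp: polygon_def)
  have "\<not> smooth_ball (polygon H) x r"
  proof
    assume "smooth_ball (polygon H) x r"
    then have smooth: "smooth_closed_curve (frontier (polygon H))"
      using triangular_ratio_ball_polygon_ge_1[OF H bd x] False by (simp add: smooth_ball_def)
    have "p \<in> frontier (polygon H)"
      using frontier_polygonI[OF H _ vertex(5) vertex(1,3)] x by blast
    moreover have "0 \<le> fst L \<bullet> (q - p)" if "L \<in> H" "height L p = 0" "q \<in> frontier (polygon H)" for L q
    proof -
      have "closed {y. 0 \<le> height L y}"
        unfolding height_def by (intro closed_Collect_le continuous_intros)
      then have "closure (polygon H) \<subseteq> {y. 0 \<le> height L y}"
        using that by (intro closure_minimal) (auto simp: polygon_def less_imp_le)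
      then have "0 \<le> height L q" using that by (auto simp: frontier_def)
      with that show ?thesis by (simp add: height_def inner_diff)
    qed
    ultimately show False
      using smooth_closed_curve_no_corner[OF smooth, of p "fst L1" "fst L2"] vertex by blast
  qed
  moreover have "\<not> (\<forall>M\<in>H. nests (fst L \<bullet> fst M) r (height L x) (height M x))" if L: "L \<in> H" for L
  proof
    assume A: "\<forall>M\<in>H. nests (fst L \<bullet> fst M) r (height L x) (height M x)"
    have "fst L = fst M" if "M \<in> H" for M
      using nests_unit_eq[OF H(2) H(2) h h] A that L False by (meson not_less)
    then have "fst L1 = fst L2" using vertex by metis
    with vertex(6) show False by simp
  qed
  ultimately show ?thesis by blast
qed

section \<open>Comparing the distances to the sides\<close>

lemma nests_less:
  assumes "nests k r u v" "k < 1" "0 < r" "0 < u" "0 < v"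
  shows "u < v"
proof -
  have "u\<^sup>2 + v\<^sup>2 - 2 * k * u * v = (v - u)\<^sup>2 + 2 * (1 - k) * (u * v)"
    by (simp add: power2_eq_square algebra_simps)
  moreover have "0 < 2 * (1 - k) * (u * v)" using assms by simp
  ultimately have "0 < u\<^sup>2 + v\<^sup>2 - 2 * k * u * v" by (smt (verit) zero_le_power2)
  then have "0 < r * sqrt (u\<^sup>2 + v\<^sup>2 - 2 * k * u * v)" using assms by simp
  then show ?thesis using assms(1) by (simp add: nests_def)
qed

text \<open>Geometrically: if the disc of one side is contained in the disc of a second one, then it is contained
  in the disc of any side more distant than the second one that makes the same angle. With
  \<open>N t = sqrt (u\<^sup>2 + t\<^sup>2 - 2 * k * u * t)\<close>, the quotient \<open>(t - u) / N t\<close> increases with \<open>t \<ge> u\<close>. This is why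
  only the nearer one of two competing sides appears in the bounds on the radius.\<close>

lemma nests_mono:
  assumes "nests k r u v" "v \<le> v'" "k < 1" "0 < r" "0 < u" "0 < v"
  shows "nests k r u v'"
proof -
  have uv: "u < v" using nests_less assms by blast
  define N where "N t = sqrt (u\<^sup>2 + t\<^sup>2 - 2 * k * u * t)" for t
  have q: "u\<^sup>2 + t\<^sup>2 - 2 * k * u * t = (t - u)\<^sup>2 + 2 * (1 - k) * u * t" for t
    by (simp add: power2_eq_square algebra_simps)
  have pos: "0 < (t - u)\<^sup>2 + 2 * (1 - k) * u * t" if "0 < t" for t
    using that assms by (intro add_nonneg_pos) auto
  have N: "0 < N t" "(N t)\<^sup>2 = (t - u)\<^sup>2 + 2 * (1 - k) * u * t" if "0 < t" for t
    using pos[OF that] by (simp_all add: N_def q)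
  have v': "0 < v'" using assms by simp
  have "(v' - u)\<^sup>2 * v - (v - u)\<^sup>2 * v' = (v' - v) * (v' * v - u * u)"
    by (simp add: power2_eq_square algebra_simps)
  moreover have "u * u \<le> v' * v" using uv assms by (intro mult_mono) auto
  ultimately have "0 \<le> (v' - u)\<^sup>2 * v - (v - u)\<^sup>2 * v'" using assms by simp
  then have "0 \<le> 2 * (1 - k) * u * ((v' - u)\<^sup>2 * v - (v - u)\<^sup>2 * v')" using assms by simp
  then have "((v - u) * N v')\<^sup>2 \<le> ((v' - u) * N v)\<^sup>2"
    unfolding power_mult_distrib N(2)[OF v'] N(2)[OF assms(6)] by (simp add: algebra_simps)
  then have "(v - u) * N v' \<le> (v' - u) * N v"
    by (rule power2_le_imp_le) (use uv assms N in \<open>auto intro!: mult_nonneg_nonneg less_imp_le\<close>)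
  moreover have "r * N v * N v' \<le> (v - u) * N v'"
    using assms(1) N(1)[OF v'] by (intro mult_right_mono) (auto simp: nests_def N_def)
  ultimately have "(r * N v') * N v \<le> (v' - u) * N v" by (simp add: mult_ac)
  then have "r * N v' \<le> v' - u" using N(1)[OF assms(6)] by simp
  then show ?thesis by (simp add: nests_def N_def)
qed

lemma nests_self: "nests 1 r u u"
  by (simp add: nests_def power2_eq_square)

section \<open>The triangle and the rectangle\<close>

lemma norm_vector2: "norm (vector [m, n] :: real^2) = sqrt (m\<^sup>2 + n\<^sup>2)"
  by (simp add: norm_vec_def L2_set_def sum_2)

lemma inner_vector2: "(vector [m, n] :: real^2) \<bullet> vector [m', n'] = m * m' + n * n'"
  by (simp add: inner_vec_def sum_2)

lemma height_vector2: "height (vector [m, n], c) y = m * y $ 1 + n * y $ 2 + c"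
  by (simp add: height_def inner_vec_def sum_2)

text \<open>The inward unit normals of the two sides through the origin and of the vertical side.\<close>

definition triangle_sides :: "((real^2) \<times> real) set" where
  "triangle_sides = {(vector [1/2, - (sqrt 3 / 2)], 0), (vector [1/2, sqrt 3 / 2], 0), (vector [-1, 0], sqrt 3)}"

text \<open>The top, bottom, right and left sides, in this order, with inward unit normals.\<close>

definition rectangle_sides :: "real \<Rightarrow> real \<Rightarrow> ((real^2) \<times> real) set" where
  "rectangle_sides a b = {(vector [0, -1], b), (vector [0, 1], b), (vector [-1, 0], a), (vector [1, 0], a)}"

lemma finite_sides: "finite triangle_sides" "finite (rectangle_sides a b)"
  by (simp_all add: triangle_sides_def rectangle_sides_def)

lemma norm_side:
  "L \<in> triangle_sides \<Longrightarrow> norm (fst L) = 1" "L \<in> rectangle_sides a b \<Longrightarrow> norm (fst L) = 1"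
  by (auto simp: triangle_sides_def rectangle_sides_def norm_vector2 power2_eq_square)

lemma triangle_G_eq: "triangle_G = polygon triangle_sides"
proof -
  have "convex hull {vector [0, 0], vector [sqrt 3, 1], vector [sqrt 3, -1 :: real]} =
        {y :: real^2. \<forall>L\<in>triangle_sides. 0 \<le> height L y}" (is "convex hull ?V = ?S")
  proof (rule subset_antisym)
    have "?V \<subseteq> ?S" by (auto simp: triangle_sides_def height_vector2)
    then show "convex hull ?V \<subseteq> ?S" using convex_closed_polygon by (rule hull_minimal)
    show "?S \<subseteq> convex hull ?V"
    proof
      fix y assume "y \<in> ?S"
      then have y: "sqrt 3 * y $ 2 \<le> y $ 1" "- (sqrt 3 * y $ 2) \<le> y $ 1" "y $ 1 \<le> sqrt 3"
        by (auto simp: triangle_sides_def height_vector2)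
      (* Barycentric coordinates: the height over each side relative to the altitude, which is sqrt 3. *)
      define u v w where "u = 1 - y $ 1 / sqrt 3" and "v = (y $ 1 / sqrt 3 + y $ 2) / 2"
        and "w = (y $ 1 / sqrt 3 - y $ 2) / 2"
      have "0 \<le> u" "0 \<le> v" "0 \<le> w" using y by (auto simp: u_def v_def w_def field_simps)
      moreover have "u + v + w = 1" by (simp add: u_def v_def w_def field_simps)
      moreover have "y = u *\<^sub>R vector [0, 0] + v *\<^sub>R vector [sqrt 3, 1] + w *\<^sub>R vector [sqrt 3, -1]"
        by (simp add: vec_eq_iff forall_2 u_def v_def w_def field_simps)
      ultimately show "y \<in> convex hull ?V" unfolding convex_hull_3 by blast
    qed
  qed
  then show ?thesis
    unfolding triangle_G_def by (simp only: interior_closed_polygon[OF finite_sides(1) norm_side(1)])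
qed

lemma rectangle_G_eq:
  assumes "0 < a" "0 < b"
  shows "rectangle_G a b = polygon (rectangle_sides a b)"
proof -
  have "convex hull {vector [a, b], vector [a, -b], vector [-a, b], vector [-a, -b]} =
        {y :: real^2. \<forall>L\<in>rectangle_sides a b. 0 \<le> height L y}" (is "convex hull ?V = ?S")
  proof (rule subset_antisym)
    have "?V \<subseteq> ?S" using assms by (auto simp: rectangle_sides_def height_vector2)
    then show "convex hull ?V \<subseteq> ?S" using convex_closed_polygon by (rule hull_minimal)
    show "?S \<subseteq> convex hull ?V"
    proof
      fix y assume "y \<in> ?S"
      then have y: "y $ 2 \<le> b" "- b \<le> y $ 2" "y $ 1 \<le> a" "- a \<le> y $ 1"
        by (auto simp: rectangle_sides_def height_vector2)
      (* First two points on the horizontal sides, then a point on the vertical segment between them. *)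
      define s t where "s = (1 + y $ 1 / a) / 2" and "t = (1 + y $ 2 / b) / 2"
      have st: "0 \<le> s" "0 \<le> 1 - s" "0 \<le> t" "0 \<le> 1 - t"
        using y assms by (auto simp: s_def t_def field_simps)
      have edge: "s *\<^sub>R vector [a, c] + (1 - s) *\<^sub>R vector [-a, c] \<in> convex hull ?V" if "c = b \<or> c = - b" for c
        using st that by (intro convexD[OF convex_convex_hull] hull_inc) auto
      have "t *\<^sub>R (s *\<^sub>R vector [a, b] + (1 - s) *\<^sub>R vector [-a, b]) +
            (1 - t) *\<^sub>R (s *\<^sub>R vector [a, -b] + (1 - s) *\<^sub>R vector [-a, -b]) \<in> convex hull ?V"
        by (rule convexD[OF convex_convex_hull edge edge]) (use st in simp_all)
      also have "t *\<^sub>R (s *\<^sub>R vector [a, b] + (1 - s) *\<^sub>R vector [-a, b]) +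
            (1 - t) *\<^sub>R (s *\<^sub>R vector [a, -b] + (1 - s) *\<^sub>R vector [-a, -b]) = y"
        using assms by (simp add: vec_eq_iff forall_2 s_def t_def field_simps)
      finally show "y \<in> convex hull ?V" .
    qed
  qed
  then show ?thesis
    unfolding rectangle_G_def by (simp only: interior_closed_polygon[OF finite_sides(2) norm_side(2)])
qed

lemma bounded_triangle_G: "bounded triangle_G"
  unfolding triangle_G_def
  by (rule bounded_subset[OF _ interior_subset]) (simp add: finite_imp_bounded_convex_hull)

lemma bounded_rectangle_G: "bounded (rectangle_G a b)"
  unfolding rectangle_G_def
  by (rule bounded_subset[OF _ interior_subset]) (simp add: finite_imp_bounded_convex_hull)

text \<open>Here \<open>lo\<close> and \<open>hi\<close> are the distances to the nearer and the farther of the two sides through the origin,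
  and \<open>w\<close> is the distance to the vertical side. The innermost disc can only belong to a nearest side.
  If that is the vertical one, the condition against the farther slanted side follows by
  monotonicity, since all pairs of sides make the same angle.\<close>

lemma smooth_ball_triangle_iff:
  assumes x: "x \<in> triangle_G" and r: "0 < r"
  defines "lo \<equiv> (x $ 1 - sqrt 3 * \<bar>x $ 2\<bar>) / 2"
    and "hi \<equiv> (x $ 1 + sqrt 3 * \<bar>x $ 2\<bar>) / 2"
    and "w \<equiv> sqrt 3 - x $ 1"
  shows "smooth_ball triangle_G x r \<longleftrightarrow>
     nests (-1/2) r lo hi \<and> nests (-1/2) r lo w \<or> nests (-1/2) r w lo"
proof -
  let ?N = "nests (-1/2) r"
  define p q where "p = (x $ 1 - sqrt 3 * x $ 2) / 2" and "q = (x $ 1 + sqrt 3 * x $ 2) / 2"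
  have heights: "height (vector [1/2, - (sqrt 3 / 2)], 0) x = p" "height (vector [1/2, sqrt 3 / 2], 0) x = q"
    "height (vector [-1, 0], sqrt 3) x = w"
    by (simp_all add: height_vector2 p_def q_def w_def field_simps)
  have pos: "0 < p" "0 < q" "0 < w"
    using x unfolding triangle_G_eq polygon_def triangle_sides_def heights[symmetric] by auto
  have "smooth_ball triangle_G x r \<longleftrightarrow>
     (\<exists>L\<in>triangle_sides. \<forall>M\<in>triangle_sides. nests (fst L \<bullet> fst M) r (height L x) (height M x))"
    unfolding triangle_G_eq
  proof (rule smooth_ball_polygon_iff[OF finite_sides(1) norm_side(1), where p = 0])
    show "bounded (polygon triangle_sides)" "x \<in> polygon triangle_sides" "0 < r"
      using bounded_triangle_G x r by (simp_all add: triangle_G_eq)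
    show "(vector [1/2, - (sqrt 3 / 2)], 0) \<in> triangle_sides" "(vector [1/2, sqrt 3 / 2], 0) \<in> triangle_sides"
      by (simp_all add: triangle_sides_def)
  qed (auto simp: triangle_sides_def height_vector2)
  also have "\<dots> \<longleftrightarrow> ?N p q \<and> ?N p w \<or> ?N q p \<and> ?N q w \<or> ?N w p \<and> ?N w q"
    by (simp add: triangle_sides_def heights inner_vector2 nests_self)
  also have "\<dots> \<longleftrightarrow> ?N lo hi \<and> ?N lo w \<or> ?N w lo"
  proof -
    have less: "u < v" if "?N u v" "0 < u" "0 < v" for u v using nests_less[OF that(1)] that r by simp
    have mono: "?N u v'" if "?N u v" "v \<le> v'" "0 < u" "0 < v" for u v v'
      using nests_mono[OF that(1)] that r by simp
    show ?thesis
    proof (cases "0 \<le> x $ 2")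
      case True
      then have "lo = p" "hi = q" by (simp_all add: lo_def hi_def p_def q_def)
      moreover have "p \<le> q" using True by (simp add: p_def q_def)
      ultimately show ?thesis using less[of q p] mono[of w p q] pos by auto
    next
      case False
      then have "lo = q" "hi = p" by (simp_all add: lo_def hi_def p_def q_def)
      moreover have "q \<le> p" using False by (simp add: p_def q_def mult_nonneg_nonpos)
      ultimately show ?thesis using less[of p q] mono[of w q p] pos by auto
    qed
  qed
  finally show ?thesis .
qed

text \<open>Here \<open>u\<close> and \<open>v\<close> are the distances to the nearer vertical and the nearer horizontal side. Against the
  opposite side the nesting condition is linear, as the feet of the perpendiculars are
  opposite points; against the two adjacent sides the nearer one decides, by monotonicity.\<close>

lemma smooth_ball_rectangle_iff:
  assumes ab: "0 < a" "0 < b" and x: "x \<in> rectangle_G a b" and r: "0 < r"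
  defines "u \<equiv> a - \<bar>x $ 1\<bar>" and "v \<equiv> b - \<bar>x $ 2\<bar>"
  shows "smooth_ball (rectangle_G a b) x r \<longleftrightarrow>
     r \<le> \<bar>x $ 2\<bar> / b \<and> nests 0 r v u \<or> r \<le> \<bar>x $ 1\<bar> / a \<and> nests 0 r u v"
proof -
  define p q s t where "p = b - x $ 2" and "q = b + x $ 2" and "s = a - x $ 1" and "t = a + x $ 1"
  have heights: "height (vector [0, -1], b) x = p" "height (vector [0, 1], b) x = q"
    "height (vector [-1, 0], a) x = s" "height (vector [1, 0], a) x = t"
    by (simp_all add: height_vector2 p_def q_def s_def t_def)
  have pos: "0 < p" "0 < q" "0 < s" "0 < t"
    using x unfolding rectangle_G_eq[OF ab] polygon_def rectangle_sides_def heights[symmetric] by auto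
  have "smooth_ball (rectangle_G a b) x r \<longleftrightarrow>
     (\<exists>L\<in>rectangle_sides a b. \<forall>M\<in>rectangle_sides a b. nests (fst L \<bullet> fst M) r (height L x) (height M x))"
    unfolding rectangle_G_eq[OF ab]
  proof (rule smooth_ball_polygon_iff[OF finite_sides(2) norm_side(2), where p = "vector [a, b]"])
    show "bounded (polygon (rectangle_sides a b))" "x \<in> polygon (rectangle_sides a b)" "0 < r"
      using bounded_rectangle_G[of a b] x r by (simp_all add: rectangle_G_eq[OF ab])
    show "(vector [0, -1], b) \<in> rectangle_sides a b" "(vector [-1, 0], a) \<in> rectangle_sides a b"
      by (simp_all add: rectangle_sides_def)
    show "height (vector [0, -1], b) (vector [a, b]) = 0" "height (vector [-1, 0], a) (vector [a, b]) = 0"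
      by (simp_all add: height_vector2)
  qed (use ab in \<open>auto simp: rectangle_sides_def height_vector2\<close>)
  also have "\<dots> \<longleftrightarrow>
     (nests (-1) r p q \<and> nests 0 r p s \<and> nests 0 r p t) \<or> (nests (-1) r q p \<and> nests 0 r q s \<and> nests 0 r q t) \<or>
     (nests (-1) r s t \<and> nests 0 r s p \<and> nests 0 r s q) \<or> (nests (-1) r t s \<and> nests 0 r t p \<and> nests 0 r t q)"
    by (simp add: rectangle_sides_def heights inner_vector2 nests_self conj_ac)
  also have "\<dots> \<longleftrightarrow> r \<le> \<bar>x $ 2\<bar> / b \<and> nests 0 r v u \<or> r \<le> \<bar>x $ 1\<bar> / a \<and> nests 0 r u v"
  proof -
    have opposite: "nests (-1) r c d \<longleftrightarrow> r * (c + d) \<le> d - c" if "0 < c" "0 < d" for c d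
    proof -
      have "c\<^sup>2 + d\<^sup>2 - 2 * (-1) * c * d = (c + d)\<^sup>2" by (simp add: power2_eq_square algebra_simps)
      then show ?thesis using that unfolding nests_def by (simp only: real_sqrt_abs) simp
    qed
    have mono: "nests 0 r c d'" if "nests 0 r c d" "d \<le> d'" "0 < c" "0 < d" for c d d'
      using nests_mono[OF that(1)] that r by simp
    have less: "c < d" if "r * (c + d) \<le> d - c" "0 < c" "0 < d" for c d
      using that r mult_pos_pos[of r "c + d"] by linarith
    (* The horizontal sides p, q compete against the vertical sides s, t; the rectangle has this
       situation twice, with the roles of the two directions exchanged. *)
    have strip: "(nests (-1) r p q \<and> nests 0 r p s \<and> nests 0 r p t) \<or> (nests (-1) r q p \<and> nests 0 r q s \<and> nests 0 r q t)
       \<longleftrightarrow> r * (p + q) \<le> \<bar>q - p\<bar> \<and> nests 0 r (min p q) (min s t)"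
      if pos: "0 < p" "0 < q" "0 < s" "0 < t" for p q s t
    proof -
      have both: "nests 0 r c s \<and> nests 0 r c t \<longleftrightarrow> nests 0 r c (min s t)" if "0 < c" for c
        using mono[of c "min s t" s] mono[of c "min s t" t] that pos by (auto simp: min_def)
      show ?thesis
      proof (cases "p \<le> q")
        case True
        then show ?thesis using less[of q p] pos by (auto simp: both opposite add.commute)
      next
        case False
        then show ?thesis using less[of p q] pos by (auto simp: both opposite add.commute)
      qed
    qed
    have mins: "min p q = v" "min s t = u" by (auto simp: p_def q_def s_def t_def u_def v_def)
    have "r * (p + q) \<le> \<bar>q - p\<bar> \<longleftrightarrow> r \<le> \<bar>x $ 2\<bar> / b"
      "r * (s + t) \<le> \<bar>t - s\<bar> \<longleftrightarrow> r \<le> \<bar>x $ 1\<bar> / a"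
      using ab by (simp_all add: p_def q_def s_def t_def abs_mult pos_le_divide_eq)
    then show ?thesis
      using strip[OF pos] strip[OF pos(3,4,1,2)] unfolding mins by argo
  qed
  finally show ?thesis .
qed

theorem theorem1p9:
  "(\<forall>(x :: real^2) (r :: real). x \<in> triangle_G \<longrightarrow> r > 0 \<longrightarrow>
      (let x1 = x $ 1; x2 = x $ 2;
           d = sqrt ((x1 - sqrt 3)^2 + (1 - \<bar>x2\<bar>)^2);
           r0 = min (2 * \<bar>x2\<bar> / norm x) ((\<bar>x2\<bar> - sqrt 3 * x1 + 2) / d);
           r1 = (sqrt 3 * x1 - 2 - \<bar>x2\<bar>) / d
       in smooth_ball triangle_G x r \<longleftrightarrow> r \<le> r0 \<or> r \<le> r1)) \<and>
   (\<forall>(a :: real) (b :: real) (x :: real^2) (r :: real).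
      a \<ge> b \<longrightarrow> b > 0 \<longrightarrow> x \<in> rectangle_G a b \<longrightarrow> r > 0 \<longrightarrow>
      (let x1 = x $ 1; x2 = x $ 2;
           d = sqrt ((a - \<bar>x1\<bar>)^2 + (b - \<bar>x2\<bar>)^2);
           r2 = min (\<bar>x2\<bar> / b) (((a - \<bar>x1\<bar>) - (b - \<bar>x2\<bar>)) / d);
           r3 = min (\<bar>x1\<bar> / a) (((b - \<bar>x2\<bar>) - (a - \<bar>x1\<bar>)) / d)
       in smooth_ball (rectangle_G a b) x r \<longleftrightarrow> r \<le> r2 \<or> r \<le> r3))"
proof (intro conjI allI impI)
  fix x :: "real^2" and r :: real
  assume x: "x \<in> triangle_G" and r: "0 < r"
  define x1 z where "x1 = x $ 1" and "z = \<bar>x $ 2\<bar>"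
  define lo hi w where "lo = (x1 - sqrt 3 * z) / 2" and "hi = (x1 + sqrt 3 * z) / 2" and "w = sqrt 3 - x1"
  define d where "d = sqrt ((x1 - sqrt 3)\<^sup>2 + (1 - z)\<^sup>2)"
  have "\<forall>L\<in>triangle_sides. 0 < height L x" using x by (simp add: triangle_G_eq polygon_def)
  then have sides: "sqrt 3 * z < x1" "x1 < sqrt 3"
    by (auto simp: triangle_sides_def height_vector2 x1_def z_def abs_if)
  have "0 \<le> z" by (simp add: z_def)
  then have "0 < x1" using sides by (smt (verit) mult_nonneg_nonneg real_sqrt_ge_zero)
  have "0 < norm x" using \<open>0 < x1\<close> by (auto simp: x1_def)
  have "0 < d" using sides by (auto simp: d_def intro!: add_pos_nonneg)
  have norm_x: "norm x = sqrt (x1\<^sup>2 + z\<^sup>2)"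
    by (simp add: norm_vec_def L2_set_def sum_2 x1_def z_def)
  (* In an equilateral triangle, the distance between the feet of two perpendiculars from x is
     sqrt 3 / 2 times the distance of x to the common vertex of the two sides (law of sines). *)
  have scale: "sqrt (u\<^sup>2 + v\<^sup>2 - 2 * (-1/2) * u * v) = sqrt 3 / 2 * sqrt c"
    if "u\<^sup>2 + v\<^sup>2 + u * v = 3 / 4 * c" for u v c :: real
  proof -
    have "sqrt (3 / 4 * c) = sqrt 3 / 2 * sqrt c" by (simp add: real_sqrt_mult real_sqrt_divide)
    moreover have "u\<^sup>2 + v\<^sup>2 - 2 * (-1/2) * u * v = 3 / 4 * c" using that by simp
    ultimately show ?thesis by (simp only:)
  qed
  have lo_hi: "nests (-1/2) r lo hi \<longleftrightarrow> r \<le> 2 * z / norm x"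
  proof -
    have "lo\<^sup>2 + hi\<^sup>2 + lo * hi = 3 / 4 * (x1\<^sup>2 + z\<^sup>2)"
      by (simp add: lo_def hi_def power2_eq_square field_simps)
    then have "nests (-1/2) r lo hi \<longleftrightarrow> r * (sqrt 3 / 2 * norm x) \<le> sqrt 3 / 2 * (2 * z)"
      unfolding nests_def norm_x by (subst scale) (auto simp: lo_def hi_def field_simps)
    also have "\<dots> \<longleftrightarrow> sqrt 3 / 2 * (r * norm x) \<le> sqrt 3 / 2 * (2 * z)" by (simp only: mult_ac)
    also have "\<dots> \<longleftrightarrow> r * norm x \<le> 2 * z" by (rule mult_le_cancel_left_pos) simp
    also have "\<dots> \<longleftrightarrow> r \<le> 2 * z / norm x" using \<open>0 < norm x\<close> by (simp add: pos_le_divide_eq)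
    finally show ?thesis .
  qed
  have lo_w_dist: "lo\<^sup>2 + w\<^sup>2 + lo * w = 3 / 4 * ((x1 - sqrt 3)\<^sup>2 + (1 - z)\<^sup>2)"
    by (simp add: lo_def w_def power2_eq_square field_simps)
  have lo_w: "nests (-1/2) r lo w \<longleftrightarrow> r \<le> (z - sqrt 3 * x1 + 2) / d"
  proof -
    have "w - lo = sqrt 3 / 2 * (z - sqrt 3 * x1 + 2)" by (simp add: lo_def w_def field_simps)
    then have "nests (-1/2) r lo w \<longleftrightarrow> r * (sqrt 3 / 2 * d) \<le> sqrt 3 / 2 * (z - sqrt 3 * x1 + 2)"
      unfolding nests_def d_def scale[OF lo_w_dist] by simp
    also have "\<dots> \<longleftrightarrow> sqrt 3 / 2 * (r * d) \<le> sqrt 3 / 2 * (z - sqrt 3 * x1 + 2)" by (simp only: mult_ac)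
    also have "\<dots> \<longleftrightarrow> r * d \<le> z - sqrt 3 * x1 + 2" by (rule mult_le_cancel_left_pos) simp
    also have "\<dots> \<longleftrightarrow> r \<le> (z - sqrt 3 * x1 + 2) / d" using \<open>0 < d\<close> by (simp add: pos_le_divide_eq)
    finally show ?thesis .
  qed
  have w_lo: "nests (-1/2) r w lo \<longleftrightarrow> r \<le> (sqrt 3 * x1 - 2 - z) / d"
  proof -
    have "lo - w = sqrt 3 / 2 * (sqrt 3 * x1 - 2 - z)" by (simp add: lo_def w_def field_simps)
    moreover have "w\<^sup>2 + lo\<^sup>2 + w * lo = 3 / 4 * ((x1 - sqrt 3)\<^sup>2 + (1 - z)\<^sup>2)"
      using lo_w_dist by (simp add: ac_simps)
    ultimately have "nests (-1/2) r w lo \<longleftrightarrow> r * (sqrt 3 / 2 * d) \<le> sqrt 3 / 2 * (sqrt 3 * x1 - 2 - z)"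
      unfolding nests_def d_def by (simp only: scale)
    also have "\<dots> \<longleftrightarrow> sqrt 3 / 2 * (r * d) \<le> sqrt 3 / 2 * (sqrt 3 * x1 - 2 - z)" by (simp only: mult_ac)
    also have "\<dots> \<longleftrightarrow> r * d \<le> sqrt 3 * x1 - 2 - z" by (rule mult_le_cancel_left_pos) simp
    also have "\<dots> \<longleftrightarrow> r \<le> (sqrt 3 * x1 - 2 - z) / d" using \<open>0 < d\<close> by (simp add: pos_le_divide_eq)
    finally show ?thesis .
  qed
  show "let x1 = x $ 1; x2 = x $ 2;
           d = sqrt ((x1 - sqrt 3)^2 + (1 - \<bar>x2\<bar>)^2);
           r0 = min (2 * \<bar>x2\<bar> / norm x) ((\<bar>x2\<bar> - sqrt 3 * x1 + 2) / d);
           r1 = (sqrt 3 * x1 - 2 - \<bar>x2\<bar>) / d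
       in smooth_ball triangle_G x r \<longleftrightarrow> r \<le> r0 \<or> r \<le> r1"
    using smooth_ball_triangle_iff[OF x r] lo_hi lo_w w_lo
    unfolding Let_def min.bounded_iff lo_def hi_def w_def d_def x1_def z_def by simp
next
  fix a b r :: real and x :: "real^2"
  assume ab: "b \<le> a" "0 < b" and x: "x \<in> rectangle_G a b" and r: "0 < r"
  define u v d where "u = a - \<bar>x $ 1\<bar>" and "v = b - \<bar>x $ 2\<bar>" and "d = sqrt (u\<^sup>2 + v\<^sup>2)"
  have a: "0 < a" using ab by simp
  have "\<forall>L\<in>rectangle_sides a b. 0 < height L x"
    using x by (simp add: rectangle_G_eq[OF a ab(2)] polygon_def)
  then have "0 < u" by (auto simp: rectangle_sides_def height_vector2 u_def abs_if)
  then have "0 < d" by (auto simp: d_def intro!: add_pos_nonneg)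
  have "nests 0 r v u \<longleftrightarrow> r \<le> (u - v) / d" "nests 0 r u v \<longleftrightarrow> r \<le> (v - u) / d"
    using \<open>0 < d\<close> by (simp_all add: nests_def pos_le_divide_eq d_def add.commute)
  then show "let x1 = x $ 1; x2 = x $ 2;
           d = sqrt ((a - \<bar>x1\<bar>)^2 + (b - \<bar>x2\<bar>)^2);
           r2 = min (\<bar>x2\<bar> / b) (((a - \<bar>x1\<bar>) - (b - \<bar>x2\<bar>)) / d);
           r3 = min (\<bar>x1\<bar> / a) (((b - \<bar>x2\<bar>) - (a - \<bar>x1\<bar>)) / d)
       in smooth_ball (rectangle_G a b) x r \<longleftrightarrow> r \<le> r2 \<or> r \<le> r3"
    using smooth_ball_rectangle_iff[OF a ab(2) x r]
    unfolding Let_def min.bounded_iff u_def v_def d_def by simp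
qed

end
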